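(* Let $n$ be a positive integer. Then $$\operatorname{cone}\Bigl(\bigcup_{\alpha\in\mathbb{R}}\bar{\mathcal{B}}(\alpha)\Bigr)=\mathcal{SDD}_n.$$
   Context: $\mathbb{S}^n$ denotes the space of real symmetric $n\times n$ matrices. Let $e_i\in\mathbb{R}^n$ be the $i$th standard basis vector. For $\alpha\in\mathbb{R}$, define the expanded SD basis $$\bar{B}_{i,j}(\alpha):=(e_i+\alpha e_j)(e_i+\alpha e_j)^T,\qquad \bar{\mathcal{B}}(\alpha):=\{\bar{B}_{i,j}(\alpha)\mid 1\le i\le j\le n\}.$$ The sets of diagonally dominant and scaled diagonally dominant matrices are $$\mathcal{DD}_n:=\{A\in\mathbb{S}^n\mid A_{i,i}\ge\sum_{j\ne i}|A_{i,j}|\ (i=1,\ldots,n)\},$$ $$\mathcal{SDD}_n:=\{A\in\mathbb{S}^n\mid DAD\in\mathcal{DD}_n\text{ for some positive diagonal matrix }D\},$$ where a positive diagonal matrix is a diagonal matrix with positive diagonal entries. For $\mathcal{K}\subseteq\mathbb{S}^n$, the conical hull is $\operatorname{cone}(\mathcal{K}):=\{\sum_{i=1}^k\alpha_iX_i\mid X_i\in\mathcal{K},\ \alpha_i\ge0,\ k\in\mathbb{Z}_{\ge0}\}$, where $\mathbb{Z}_{\ge 0}$ is the set of nonnegative integers (the empty sum is the zero matrix). *)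

theory Defs
  imports "HOL-Analysis.Analysis"
begin

text \<open>
  The index set \<open>{1, \<dots>, n}\<close> is an arbitrary finite linearly ordered type \<open>'n\<close>, so that
  \<open>n = CARD('n) \<ge> 1\<close>; the order is only used for the condition \<open>i \<le> j\<close> on the basis.
\<close>

definition sym_mats :: "(real^'n^'n) set" where
  "sym_mats = {A. transpose A = A}"

text \<open>\<open>columnvector\<close> and \<open>rowvector\<close> are polymorphic in the dummy dimension; the type
  annotation with \<open>1\<close> is what makes the product equal to \<open>v v\<^sup>T\<close>.\<close>

definition outer_square :: "real^'n \<Rightarrow> real^'n^'n" where
  "outer_square v = (columnvector v :: real^1^'n) ** transpose (columnvector v :: real^1^'n)"

definition sd_mat :: "real \<Rightarrow> 'n::finite \<Rightarrow> 'n \<Rightarrow> real^'n^'n" where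
  "sd_mat \<alpha> i j = outer_square (axis i 1 + \<alpha> *\<^sub>R axis j 1)"

definition sd_basis :: "real \<Rightarrow> (real^'n::{finite,linorder}^'n::{finite,linorder}) set" where
  "sd_basis \<alpha> = {sd_mat \<alpha> i j | i j. i \<le> j}"

definition DD :: "(real^'n^'n) set" where
  "DD = {A \<in> sym_mats. \<forall>i. A $ i $ i \<ge> (\<Sum>j\<in>UNIV - {i}. \<bar>A $ i $ j\<bar>)}"

definition pos_diagonal :: "real^'n^'n \<Rightarrow> bool" where
  "pos_diagonal D \<longleftrightarrow> (\<forall>i j. i \<noteq> j \<longrightarrow> D $ i $ j = 0) \<and> (\<forall>i. D $ i $ i > 0)"

definition SDD :: "(real^'n^'n) set" where
  "SDD = {A \<in> sym_mats. \<exists>D. pos_diagonal D \<and> D ** A ** D \<in> DD}"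

text \<open>The empty sum \<open>k = 0\<close> is allowed, so the zero matrix always belongs to the conical hull.\<close>

definition conical_hull :: "(real^'n^'n) set \<Rightarrow> (real^'n^'n) set" where
  "conical_hull K =
    {\<Sum>i<k. c i *\<^sub>R X i | (k::nat) (c :: nat \<Rightarrow> real) (X :: nat \<Rightarrow> real^'n^'n).
       \<forall>i<k. X i \<in> K \<and> c i \<ge> 0}"

end

theory Submission
  imports Defs
begin

text \<open>
  Diagonal scaling turns membership in the scaled diagonally dominant cone into a linear condition:
  a symmetric \<open>A\<close> qualifies iff some \<open>d > 0\<close> satisfies
  \<open>\<Sum>j\<noteq>i. \<bar>A i j\<bar> * d j \<le> A i i * d i\<close> for all \<open>i\<close>, that is, iff the
  comparison matrix of \<open>A\<close> (keep the diagonal, replace the other entries by \<open>- \<bar>A i j\<bar>\<close>)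
  maps a positive vector to a nonnegative one (\<open>SDD_iff\<close>).

  Such a \<open>d\<close> decomposes \<open>A\<close>. For \<open>i < j\<close> the rank-one matrix with diagonal entries
  \<open>\<bar>A i j\<bar> * d j / d i\<close> at \<open>i\<close> and \<open>\<bar>A i j\<bar> * d i / d j\<close> at \<open>j\<close> and with
  \<open>A i j\<close> off the diagonal is a nonnegative multiple of a basis matrix. Summing over all pairs
  reproduces the off-diagonal part of \<open>A\<close>, and the condition on \<open>d\<close> says that the diagonal
  which remains is nonnegative (\<open>scaled_dominant_in_conical_hull\<close>).

  Conversely, the quadratic form of the comparison matrix is superadditive in \<open>A\<close> on nonnegative
  vectors, since \<open>\<bar>a + b\<bar> \<le> \<bar>a\<bar> + \<bar>b\<bar>\<close>. On a basis matrix it is a perfect square, so it is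
  nonnegative on the whole conical hull (\<open>comparison_form_conical_hull\<close>). It remains to
  pass from a copositive matrix with nonpositive off-diagonal entries to a positive vector with
  nonnegative image. This would follow from Perron--Frobenius theory applied to each irreducible block,
  but eliminating one index at a time by Schur complements is elementary and treats the
  reducible and singular cases alike (\<open>copositive_Z_matrix_dominant\<close>).
\<close>

section \<open>Positive vectors for copositive Z-matrices\<close>

lemma quadratic_form_insert:
  fixes M :: "'a \<Rightarrow> 'a \<Rightarrow> real"
  assumes S: "finite S" "k \<notin> S" and sym: "\<And>i j. M i j = M j i"
  shows "(\<Sum>i\<in>insert k S. \<Sum>j\<in>insert k S. M i j * (x(k := t)) i * (x(k := t)) j) =
    M k k * t\<^sup>2 + 2 * t * (\<Sum>j\<in>S. M k j * x j) + (\<Sum>i\<in>S. \<Sum>j\<in>S. M i j * x i * x j)"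
proof -
  have inner: "(\<Sum>j\<in>insert k S. M i j * (x(k := t)) i * (x(k := t)) j) =
      (x(k := t)) i * (M i k * t + (\<Sum>j\<in>S. M i j * x j))" for i
  proof -
    have "(\<Sum>j\<in>S. M i j * (x(k := t)) i * (x(k := t)) j) = (\<Sum>j\<in>S. (x(k := t)) i * (M i j * x j))"
      using S by (intro sum.cong) auto
    also have "\<dots> = (x(k := t)) i * (\<Sum>j\<in>S. M i j * x j)"
      by (simp only: sum_distrib_left)
    finally show ?thesis
      using S by (simp add: algebra_simps)
  qed
  have "(\<Sum>i\<in>S. (x(k := t)) i * (M i k * t + (\<Sum>j\<in>S. M i j * x j))) =
      (\<Sum>i\<in>S. t * (M k i * x i) + (\<Sum>j\<in>S. M i j * x i * x j))"
  proof (intro sum.cong refl)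
    fix i assume "i \<in> S"
    with S have "(x(k := t)) i = x i" by auto
    then show "(x(k := t)) i * (M i k * t + (\<Sum>j\<in>S. M i j * x j)) =
        t * (M k i * x i) + (\<Sum>j\<in>S. M i j * x i * x j)"
      unfolding sym[of i k] by (simp add: algebra_simps sum_distrib_left)
  qed
  also have "\<dots> = t * (\<Sum>j\<in>S. M k j * x j) + (\<Sum>i\<in>S. \<Sum>j\<in>S. M i j * x i * x j)"
    by (simp add: sum.distrib sum_distrib_left)
  finally show ?thesis
    using S by (simp only: inner sum.insert) (simp add: algebra_simps power2_eq_square)
qed

text \<open>
  Eliminating the index \<open>k\<close> replaces \<open>M\<close> by its Schur complement, which is again a symmetric
  matrix with nonpositive off-diagonal entries. It is again copositive because its quadratic form is
  the minimum over \<open>t\<close> of the form of \<open>M\<close> at \<open>x(k := t)\<close>, and for \<open>x \<ge> 0\<close> the minimiser is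
  nonnegative. A positive vector for the complement extends by solving row \<open>k\<close> for \<open>d k\<close>, which
  comes out positive unless row \<open>k\<close> vanishes off the diagonal; in that case \<open>k\<close> is decoupled from
  the other indices.
\<close>
lemma copositive_Z_matrix_dominant:
  fixes M :: "'a \<Rightarrow> 'a \<Rightarrow> real"
  assumes "finite S"
    and "\<And>i j. M i j = M j i"
    and "\<And>i j. i \<noteq> j \<Longrightarrow> M i j \<le> 0"
    and "\<And>x. (\<And>i. x i \<ge> 0) \<Longrightarrow> (\<Sum>i\<in>S. \<Sum>j\<in>S. M i j * x i * x j) \<ge> 0"
  shows "\<exists>d. (\<forall>i. d i > 0) \<and> (\<forall>i\<in>S. (\<Sum>j\<in>S. M i j * d j) \<ge> 0)"
  using assms
proof (induction S arbitrary: M rule: finite_induct)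
  case empty
  then show ?case by (auto intro: exI[of _ "\<lambda>_. 1"])
next
  case (insert k S)
  note sym = insert.prems(1) and nonpos = insert.prems(2)
  have form: "M k k * t\<^sup>2 + 2 * t * (\<Sum>j\<in>S. M k j * x j) + (\<Sum>i\<in>S. \<Sum>j\<in>S. M i j * x i * x j) \<ge> 0"
    if "\<And>i. x i \<ge> 0" "t \<ge> 0" for x :: "'a \<Rightarrow> real" and t
    using insert.prems(3)[of "x(k := t)"] that
    unfolding quadratic_form_insert[where M = M, OF insert.hyps sym] by simp
  have extend: "(\<Sum>j\<in>insert k S. M i j * (d(k := t)) j) = M i k * t + (\<Sum>j\<in>S. M i j * d j)" for d :: "'a \<Rightarrow> real" and t i
  proof -
    have "(\<Sum>j\<in>S. M i j * (d(k := t)) j) = (\<Sum>j\<in>S. M i j * d j)"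
      using insert.hyps by (intro sum.cong) auto
    then show ?thesis using insert.hyps by simp
  qed
  have swap: "M i k = M k i" if "i \<in> S" for i
    by (rule sym)
  show ?case
  proof (cases "\<forall>j\<in>S. M k j = 0")
    case True
    have "\<exists>d. (\<forall>i. d i > 0) \<and> (\<forall>i\<in>S. (\<Sum>j\<in>S. M i j * d j) \<ge> 0)"
      using form[where t = 0] by (intro insert.IH sym nonpos) auto
    then obtain d where d: "\<And>i. d i > 0" "\<And>i. i \<in> S \<Longrightarrow> (\<Sum>j\<in>S. M i j * d j) \<ge> 0"
      by blast
    have "M k k \<ge> 0"
      using form[of "\<lambda>_. 0" 1] by simp
    then have "\<forall>i\<in>insert k S. (\<Sum>j\<in>insert k S. M i j * (d(k := 1)) j) \<ge> 0"
      unfolding extend using True d swap by simp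
    then show ?thesis
      using d(1) by (intro exI[of _ "d(k := 1)"]) auto
  next
    case False
    then obtain l where l: "l \<in> S" "M k l < 0"
      using nonpos[of k] insert.hyps(2) by (metis order.order_iff_strict)
    have Mkk: "M k k > 0"
    proof (rule ccontr)
      assume "\<not> M k k > 0"
      define x where "x = (\<lambda>i. if i = l then 1 else 0 :: real)"
      \<comment> \<open>If \<open>M k k \<le> 0\<close>, the form at \<open>x(k := t)\<close> is at most \<open>M l l + 2 * t * M k l\<close>, and this \<open>t\<close> makes that bound negative.\<close>
      define t where "t = (\<bar>M l l\<bar> + 1) / (- 2 * M k l)"
      have row: "(\<Sum>j\<in>S. M i j * x j) = M i l" for i
        using l(1) insert.hyps(1) by (simp add: x_def if_distrib cong: if_cong)
      have "(\<Sum>i\<in>S. \<Sum>j\<in>S. M i j * x i * x j) = (\<Sum>i\<in>S. x i * (\<Sum>j\<in>S. M i j * x j))"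
        by (simp add: sum_distrib_left mult_ac)
      also have "\<dots> = (\<Sum>i\<in>S. x i * M i l)"
        by (simp only: row)
      also have "\<dots> = (\<Sum>i\<in>S. M l i * x i)"
        by (intro sum.cong refl) (metis sym mult.commute)
      also have "\<dots> = M l l"
        by (rule row)
      finally have "(\<Sum>i\<in>S. \<Sum>j\<in>S. M i j * x i * x j) = M l l" .
      moreover have "x i \<ge> 0" for i
        by (simp add: x_def)
      moreover have "t \<ge> 0"
        unfolding t_def using l by (intro divide_nonneg_pos) auto
      ultimately have "M k k * t\<^sup>2 + 2 * t * M k l + M l l \<ge> 0"
        using form[of x t] row by simp
      moreover have "M k k * t\<^sup>2 \<le> 0"
        using \<open>\<not> M k k > 0\<close> by (simp add: mult_nonpos_nonneg)
      moreover have "2 * t * M k l = - (\<bar>M l l\<bar> + 1)"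
        using l by (simp add: t_def field_simps)
      ultimately show False by linarith
    qed
    define N where "N i j = M i j - M i k * M k j / M k k" for i j
    have N_row: "(\<Sum>j\<in>S. N i j * x j) =
        (\<Sum>j\<in>S. M i j * x j) - M i k * (\<Sum>j\<in>S. M k j * x j) / M k k" for i x
      by (simp add: N_def algebra_simps sum_subtractf sum_distrib_left sum_divide_distrib)
    have "\<exists>d. (\<forall>i. d i > 0) \<and> (\<forall>i\<in>S. (\<Sum>j\<in>S. N i j * d j) \<ge> 0)"
    proof (rule insert.IH)
      show "N i j = N j i" for i j
        using sym by (simp add: N_def mult.commute)
      show "N i j \<le> 0" if "i \<noteq> j" for i j
      proof (cases "i = k \<or> j = k")
        case True
        \<comment> \<open>Elimination clears row and column \<open>k\<close>, so the sign condition, imposed on all indices, survives at \<open>k \<notin> S\<close>.\<close>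
        then have "N i j = 0"
          using Mkk by (auto simp: N_def)
        then show ?thesis by simp
      next
        case False
        then have "M i k * M k j \<ge> 0"
          using nonpos[of i k] nonpos[of k j] by (intro mult_nonpos_nonpos) auto
        then have "M i k * M k j / M k k \<ge> 0"
          using Mkk by simp
        then show ?thesis
          using nonpos[OF that] by (simp add: N_def)
      qed
      show "(\<Sum>i\<in>S. \<Sum>j\<in>S. N i j * x i * x j) \<ge> 0" if x: "\<And>i. x i \<ge> 0" for x :: "'a \<Rightarrow> real"
      proof -
        define b where "b = (\<Sum>j\<in>S. M k j * x j)"
        have "b \<le> 0"
          unfolding b_def using x nonpos insert.hyps(2)
          by (intro sum_nonpos) (metis mult_nonpos_nonneg)
        have "(\<Sum>i\<in>S. \<Sum>j\<in>S. N i j * x i * x j) = (\<Sum>i\<in>S. x i * (\<Sum>j\<in>S. N i j * x j))"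
          by (simp add: sum_distrib_left mult_ac)
        also have "\<dots> = (\<Sum>i\<in>S. (\<Sum>j\<in>S. M i j * x i * x j) - b / M k k * (M k i * x i))"
          unfolding N_row b_def[symmetric] using swap
          by (intro sum.cong) (auto simp: algebra_simps sum_distrib_left)
        also have "\<dots> = (\<Sum>i\<in>S. \<Sum>j\<in>S. M i j * x i * x j) - b / M k k * b"
          by (simp only: sum_subtractf sum_distrib_left[symmetric] b_def[symmetric])
        also have "\<dots> = M k k * (- b / M k k)\<^sup>2 + 2 * (- b / M k k) * b
            + (\<Sum>i\<in>S. \<Sum>j\<in>S. M i j * x i * x j)"
          using Mkk by (simp add: field_simps power2_eq_square)
        also have "\<dots> \<ge> 0"
          unfolding b_def using \<open>b \<le> 0\<close> Mkk
          by (intro form x) (simp add: b_def divide_nonpos_pos)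
        finally show ?thesis .
      qed
    qed
    then obtain d where d: "\<And>i. d i > 0" and dN: "\<And>i. i \<in> S \<Longrightarrow> (\<Sum>j\<in>S. N i j * d j) \<ge> 0"
      by blast
    define b where "b = (\<Sum>j\<in>S. M k j * d j)"
    have "b < (\<Sum>j\<in>S. 0)"
      unfolding b_def
    proof (rule sum_strict_mono_ex1)
      show "\<forall>j\<in>S. M k j * d j \<le> 0"
        using nonpos d insert.hyps(2) by (metis less_imp_le mult_nonpos_nonneg)
      show "\<exists>j\<in>S. M k j * d j < 0"
        using l d by (auto intro!: bexI[of _ l] mult_neg_pos)
    qed (rule insert.hyps)
    then have dk: "- b / M k k > 0"
      using Mkk by (simp add: divide_neg_pos)
    have "(\<Sum>j\<in>insert k S. M i j * (d(k := - b / M k k)) j) \<ge> 0" if "i \<in> insert k S" for i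
    proof (cases "i = k")
      case True
      then show ?thesis unfolding extend using Mkk by (simp add: b_def)
    next
      case False
      then have "(\<Sum>j\<in>S. N i j * d j) \<ge> 0" using dN that by blast
      then show ?thesis unfolding extend N_row b_def by simp
    qed
    then show ?thesis
      using d dk by (intro exI[of _ "d(k := - b / M k k)"]) auto
  qed
qed

section \<open>Scaled diagonal dominance as a linear condition on the scaling\<close>

lemma diagonal_congruence_nth:
  fixes A D :: "real^'n^'n"
  assumes "\<And>i j. i \<noteq> j \<Longrightarrow> D $ i $ j = 0"
  shows "(D ** A ** D) $ i $ j = D $ i $ i * A $ i $ j * D $ j $ j"
proof -
  have D: "D $ i $ j = (if i = j then D $ i $ i else 0)" for i j
    using assms by simp
  have left: "(D ** A) $ i $ k = D $ i $ i * A $ i $ k" for k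
    unfolding matrix_matrix_mult_def
    by (subst D) (simp add: if_distrib[where f = "\<lambda>y. y * c" for c] cong: if_cong)
  have "(D ** A ** D) $ i $ j = (\<Sum>k\<in>UNIV. (D ** A) $ i $ k * D $ k $ j)"
    by (simp add: matrix_matrix_mult_def)
  also have "\<dots> = D $ i $ i * A $ i $ j * D $ j $ j"
    unfolding left by (subst D) (simp add: if_distrib cong: if_cong)
  finally show ?thesis .
qed

lemma sym_mats_iff: "A \<in> sym_mats \<longleftrightarrow> (\<forall>i j. A $ i $ j = A $ j $ i)"
  by (auto simp: sym_mats_def transpose_def vec_eq_iff)

text \<open>
  The scaling vector is the diagonal of \<open>D\<close>: every term of the dominance inequality for row \<open>i\<close>
  of \<open>D ** A ** D\<close> contains the positive factor \<open>D i i\<close>, which cancels.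
\<close>
lemma SDD_iff:
  fixes A :: "real^'n^'n"
  shows "A \<in> SDD \<longleftrightarrow> A \<in> sym_mats \<and>
    (\<exists>d. (\<forall>i. d i > 0) \<and> (\<forall>i. (\<Sum>j\<in>UNIV - {i}. \<bar>A $ i $ j\<bar> * d j) \<le> A $ i $ i * d i))"
proof -
  have scale: "D ** A ** D \<in> DD \<longleftrightarrow>
      (\<forall>i. (\<Sum>j\<in>UNIV - {i}. \<bar>A $ i $ j\<bar> * D $ j $ j) \<le> A $ i $ i * D $ i $ i)"
    if "A \<in> sym_mats" "pos_diagonal D" for D
  proof -
    have pos: "D $ i $ i > 0" for i
      using that(2) by (simp add: pos_diagonal_def)
    have entry: "(D ** A ** D) $ i $ j = D $ i $ i * A $ i $ j * D $ j $ j" for i j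
      using that(2) by (intro diagonal_congruence_nth) (simp add: pos_diagonal_def)
    have "D ** A ** D \<in> sym_mats"
      using that(1) by (simp add: sym_mats_iff entry)
    moreover have "(\<Sum>j\<in>UNIV - {i}. \<bar>(D ** A ** D) $ i $ j\<bar>) =
        D $ i $ i * (\<Sum>j\<in>UNIV - {i}. \<bar>A $ i $ j\<bar> * D $ j $ j)" for i
      using pos by (simp add: entry abs_mult sum_distrib_left mult.assoc less_imp_le)
    ultimately show ?thesis
      using pos by (simp add: DD_def entry mult.assoc mult_le_cancel_left_pos)
  qed
  show ?thesis
  proof safe
    assume "A \<in> SDD"
    then show "A \<in> sym_mats" by (simp add: SDD_def)
    from \<open>A \<in> SDD\<close> obtain D where D: "pos_diagonal D" "D ** A ** D \<in> DD"
      by (auto simp: SDD_def)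
    with scale[OF \<open>A \<in> sym_mats\<close>] show
      "\<exists>d. (\<forall>i. d i > 0) \<and> (\<forall>i. (\<Sum>j\<in>UNIV - {i}. \<bar>A $ i $ j\<bar> * d j) \<le> A $ i $ i * d i)"
      by (intro exI[of _ "\<lambda>i. D $ i $ i"]) (auto simp: pos_diagonal_def)
  next
    fix d
    assume A: "A \<in> sym_mats" and d: "\<forall>i. d i > 0"
      "\<forall>i. (\<Sum>j\<in>UNIV - {i}. \<bar>A $ i $ j\<bar> * d j) \<le> A $ i $ i * d i"
    define D :: "real^'n^'n" where "D = (\<chi> i j. if i = j then d i else 0)"
    have "pos_diagonal D"
      using d(1) by (simp add: D_def pos_diagonal_def)
    moreover from scale[OF A this] have "D ** A ** D \<in> DD"
      using d(2) by (simp add: D_def)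
    ultimately show "A \<in> SDD"
      using A by (auto simp: SDD_def)
  qed
qed

section \<open>Decomposing a scaled diagonally dominant matrix\<close>

lemma outer_square_nth: "outer_square v $ a $ b = v $ a * v $ b"
  by (simp add: outer_square_def columnvector_def transpose_def matrix_matrix_mult_def)

lemma sd_mat_nth:
  "sd_mat \<alpha> i j $ a $ b =
    (of_bool (a = i) + \<alpha> * of_bool (a = j)) * (of_bool (b = i) + \<alpha> * of_bool (b = j))"
  by (simp add: sd_mat_def outer_square_nth axis_def)

lemma sum_in_conical_hull:
  fixes X :: "'i \<Rightarrow> real^'n^'n"
  assumes "finite I" and "\<And>p. p \<in> I \<Longrightarrow> X p \<in> K" and "\<And>p. p \<in> I \<Longrightarrow> c p \<ge> 0"
  shows "(\<Sum>p\<in>I. c p *\<^sub>R X p) \<in> conical_hull K"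
proof -
  obtain h where "bij_betw h {..<card I} I"
    using ex_bij_betw_nat_finite[OF assms(1)] by (auto simp: atLeast0LessThan)
  then have h: "h m \<in> I" if "m < card I" for m
    using that by (auto dest: bij_betwE)
  have "(\<Sum>p\<in>I. c p *\<^sub>R X p) = (\<Sum>m<card I. c (h m) *\<^sub>R X (h m))"
    by (rule sum.reindex_bij_betw[symmetric]) fact
  then show ?thesis
    using assms(2,3) h unfolding conical_hull_def
    by (intro CollectI exI[of _ "card I"] exI[of _ "\<lambda>m. c (h m)"] exI[of _ "\<lambda>m. X (h m)"]) auto
qed

text \<open>
  The weight and the parameter used for the pair \<open>i < j\<close> are forced by the requirement that the
  rank-one matrix have the entry \<open>A i j\<close> and the diagonal entry \<open>\<bar>A i j\<bar> * d j / d i\<close> at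
  \<open>i\<close>: the latter is the share of the diagonal entry at \<open>i\<close> that the domination inequality
  reserves for the column \<open>j\<close>. The pairs \<open>i = j\<close>, with parameter \<open>0\<close>, take up the slack.
\<close>
lemma scaled_dominant_in_conical_hull:
  fixes A :: "real^'n::{finite,linorder}^'n::{finite,linorder}"
  assumes A: "A \<in> sym_mats" and d: "\<And>i. d i > 0"
    and dom: "\<And>i. (\<Sum>j\<in>UNIV - {i}. \<bar>A $ i $ j\<bar> * d j) \<le> A $ i $ i * d i"
  shows "A \<in> conical_hull (\<Union>\<alpha>. sd_basis \<alpha>)"
proof -
  define share where "share i j = \<bar>A $ i $ j\<bar> * d j / d i" for i j
  define slack where "slack i = A $ i $ i - (\<Sum>j\<in>UNIV - {i}. share i j)" for i
  define c where "c i j = (if i = j then slack i else share i j)" for i j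
  define \<alpha> where "\<alpha> i j = (if i = j then 0 else sgn (A $ i $ j) * d i / d j)" for i j
  have sym: "A $ i $ j = A $ j $ i" for i j
    using A by (simp add: sym_mats_iff)
  have "slack i \<ge> 0" for i
  proof -
    have "(\<Sum>j\<in>UNIV - {i}. share i j) = (\<Sum>j\<in>UNIV - {i}. \<bar>A $ i $ j\<bar> * d j) / d i"
      by (simp add: share_def sum_divide_distrib)
    also have "\<dots> \<le> A $ i $ i"
      using dom[of i] d[of i] by (simp add: pos_divide_le_eq)
    finally show ?thesis by (simp add: slack_def)
  qed
  then have c: "c i j \<ge> 0" for i j
    using d[of i] d[of j] by (simp add: c_def share_def)

  have diag_term: "c i i * sd_mat (\<alpha> i i) i i $ a $ b = (if i = a then if a = b then slack a else 0 else 0)"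
    for i a b
    by (auto simp: sd_mat_nth c_def \<alpha>_def)
  have pair_diag: "c i j * sd_mat (\<alpha> i j) i j $ a $ a =
      (if i = a then share a j else 0) + (if j = a then share a i else 0)" if "i \<noteq> j" for i j a
  proof -
    have "share i j * (\<alpha> i j)\<^sup>2 = share j i"
      using that d[of i] d[of j] sym[of i j]
      by (cases "A $ i $ j = 0") (auto simp: share_def \<alpha>_def power_mult_distrib power_divide
          field_simps power2_eq_square sgn_mult[symmetric] sgn_if)
    then show ?thesis
      using that by (auto simp: sd_mat_nth c_def power2_eq_square)
  qed
  have pair_offdiag: "c i j * sd_mat (\<alpha> i j) i j $ a $ b =
      (if i = a then if j = b then A $ a $ b else 0 else 0) +
      (if i = b then if j = a then A $ a $ b else 0 else 0)" if "i \<noteq> j" "a \<noteq> b" for i j a b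
  proof -
    have "share i j * \<alpha> i j = A $ i $ j"
      using that d[of i] d[of j] by (simp add: share_def \<alpha>_def abs_mult_sgn[symmetric] field_simps sgn_if)
    then show ?thesis
      using that sym[of a b] by (auto simp: sd_mat_nth c_def)
  qed

  have "A = (\<Sum>(i, j)\<in>{(i, j). i \<le> j}. c i j *\<^sub>R sd_mat (\<alpha> i j) i j)" (is "_ = ?R")
  proof (simp only: vec_eq_iff, intro allI)
    fix a b
    define f where "f i j = c i j * sd_mat (\<alpha> i j) i j $ a $ b" for i j
    have "?R $ a $ b = (\<Sum>p\<in>{p. fst p \<le> snd p}. f (fst p) (snd p))"
      by (simp add: f_def case_prod_unfold)
    also have "\<dots> = (\<Sum>p\<in>UNIV \<times> UNIV. if fst p \<le> snd p then f (fst p) (snd p) else 0)"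
      by (simp add: sum.inter_filter[symmetric])
    also have "\<dots> = (\<Sum>i\<in>UNIV. \<Sum>j\<in>UNIV. if i \<le> j then f i j else 0)"
      by (simp only: sum.cartesian_product case_prod_unfold)
    also have "\<dots> = (\<Sum>i\<in>UNIV. \<Sum>j\<in>UNIV. (if i = j then f i i else 0) + (if i < j then f i j else 0))"
      by (intro sum.cong) auto
    also have "\<dots> = (\<Sum>i\<in>UNIV. f i i) + (\<Sum>i\<in>UNIV. \<Sum>j\<in>UNIV. if i < j then f i j else 0)"
      by (simp add: sum.distrib)
    finally have split: "?R $ a $ b =
      (\<Sum>i\<in>UNIV. f i i) + (\<Sum>i\<in>UNIV. \<Sum>j\<in>UNIV. if i < j then f i j else 0)" .
    have diag: "(\<Sum>i\<in>UNIV. f i i) = (if a = b then slack a else 0)"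
      by (simp add: f_def diag_term)
    show "A $ a $ b = ?R $ a $ b"
    proof (cases "a = b")
      case True
      have "(\<Sum>i\<in>UNIV. \<Sum>j\<in>UNIV. if i < j then f i j else 0) =
          (\<Sum>i\<in>UNIV. \<Sum>j\<in>UNIV. (if i = a then if a < j then share a j else 0 else 0) +
            (if j = a then if i < a then share a i else 0 else 0))"
        using True by (intro sum.cong) (auto simp: f_def pair_diag)
      also have "\<dots> = (\<Sum>i\<in>UNIV. (if i = a then \<Sum>j\<in>UNIV. if a < j then share a j else 0 else 0) +
          (if i < a then share a i else 0))"
        by (intro sum.cong refl) (auto simp: sum.distrib)
      also have "\<dots> = (\<Sum>j\<in>UNIV. (if a < j then share a j else 0) + (if j < a then share a j else 0))"
        by (simp add: sum.distrib)
      also have "\<dots> = (\<Sum>j\<in>UNIV. if j \<noteq> a then share a j else 0)"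
        by (intro sum.cong) auto
      also have "\<dots> = (\<Sum>j\<in>UNIV - {a}. share a j)"
        by (simp add: sum.inter_filter[symmetric] set_diff_eq)
      finally show ?thesis
        unfolding split diag using True by (simp add: slack_def)
    next
      case False
      have "(\<Sum>i\<in>UNIV. \<Sum>j\<in>UNIV. if i < j then f i j else 0) =
          (\<Sum>i\<in>UNIV. \<Sum>j\<in>UNIV. (if j = b then if i = a then if a < b then A $ a $ b else 0 else 0 else 0) +
            (if j = a then if i = b then if b < a then A $ a $ b else 0 else 0 else 0))"
        using False by (intro sum.cong) (auto simp: f_def pair_offdiag)
      also have "\<dots> = A $ a $ b"
        using False by (auto simp: sum.distrib)
      finally show ?thesis
        unfolding split diag using False by simp
    qed
  qed
  also have "\<dots> = (\<Sum>p\<in>{(i, j). i \<le> j}. c (fst p) (snd p) *\<^sub>R sd_mat (\<alpha> (fst p) (snd p)) (fst p) (snd p))"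
    by (simp add: case_prod_beta)
  also have "\<dots> \<in> conical_hull (\<Union>\<alpha>. sd_basis \<alpha>)"
  proof (rule sum_in_conical_hull)
    show "sd_mat (\<alpha> (fst p) (snd p)) (fst p) (snd p) \<in> (\<Union>\<alpha>. sd_basis \<alpha>)"
      if "p \<in> {(i, j). i \<le> j}" for p
      using that unfolding sd_basis_def by (cases p) (simp, blast)
  qed (simp_all add: c)
  finally show ?thesis .
qed

section \<open>The comparison matrix on the conical hull\<close>

definition comparison :: "real^'n^'n \<Rightarrow> 'n \<Rightarrow> 'n \<Rightarrow> real" where
  "comparison A i j = (if i = j then A $ i $ j else - \<bar>A $ i $ j\<bar>)"

lemma comparison_sum_le:
  assumes "\<And>m. m \<in> I \<Longrightarrow> c m \<ge> 0"
  shows "(\<Sum>m\<in>I. c m * comparison (X m) i j) \<le> comparison (\<Sum>m\<in>I. c m *\<^sub>R X m) i j"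
proof (cases "i = j")
  case False
  have "\<bar>\<Sum>m\<in>I. c m * X m $ i $ j\<bar> \<le> (\<Sum>m\<in>I. \<bar>c m * X m $ i $ j\<bar>)"
    by (rule sum_abs)
  also have "\<dots> = (\<Sum>m\<in>I. c m * \<bar>X m $ i $ j\<bar>)"
    using assms by (intro sum.cong) (auto simp: abs_mult)
  finally show ?thesis
    using False by (simp add: comparison_def sum_negf)
qed (simp add: comparison_def)

text \<open>
  For \<open>v = e i + \<alpha> e j\<close> with \<open>i \<noteq> j\<close>, only the values \<open>p\<close> and \<open>q\<close> of \<open>\<bar>v a\<bar> * x a\<close> at
  \<open>i\<close> and \<open>j\<close> enter the form, which equals
  \<open>2 * (p\<^sup>2 + q\<^sup>2) - (p + q)\<^sup>2 = (p - q)\<^sup>2\<close>. That \<open>v\<close> has at most two nonzero entries is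
  essential here. For \<open>i = j\<close> the form is \<open>p\<^sup>2\<close>.
\<close>
lemma comparison_form_sd_mat:
  fixes i j :: "'n::finite"
  shows "(\<Sum>a\<in>UNIV. \<Sum>b\<in>UNIV. comparison (sd_mat \<alpha> i j) a b * x a * x b) \<ge> 0"
proof -
  define w where "w a = \<bar>of_bool (a = i) + \<alpha> * of_bool (a = j)\<bar> * x a" for a
  have "(\<Sum>a\<in>UNIV. \<Sum>b\<in>UNIV. comparison (sd_mat \<alpha> i j) a b * x a * x b) =
      (\<Sum>a\<in>UNIV. \<Sum>b\<in>UNIV. (if b = a then 2 * (w a)\<^sup>2 else 0) - w a * w b)"
    by (intro sum.cong refl) (auto simp: comparison_def sd_mat_nth w_def abs_mult power2_eq_square algebra_simps)
  also have "\<dots> = 2 * (\<Sum>a\<in>UNIV. (w a)\<^sup>2) - (\<Sum>a\<in>UNIV. w a)\<^sup>2"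
    by (simp only: sum_subtractf sum_product power2_eq_square) (simp add: sum_distrib_left)
  also have "(\<Sum>a\<in>UNIV. (w a)\<^sup>2) = (\<Sum>a\<in>{i, j}. (w a)\<^sup>2)"
    by (rule sum.mono_neutral_right) (auto simp: w_def)
  also have "(\<Sum>a\<in>UNIV. w a) = (\<Sum>a\<in>{i, j}. w a)"
    by (rule sum.mono_neutral_right) (auto simp: w_def)
  also have "2 * (\<Sum>a\<in>{i, j}. (w a)\<^sup>2) - (\<Sum>a\<in>{i, j}. w a)\<^sup>2 \<ge> 0"
  proof (cases "i = j")
    case False
    then have "2 * (\<Sum>a\<in>{i, j}. (w a)\<^sup>2) - (\<Sum>a\<in>{i, j}. w a)\<^sup>2 = (w i - w j)\<^sup>2"
      by (simp add: power2_eq_square algebra_simps)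
    then show ?thesis by simp
  qed simp
  finally show ?thesis .
qed

lemma comparison_form_conical_hull:
  fixes A :: "real^'n::{finite,linorder}^'n::{finite,linorder}"
  assumes "A \<in> conical_hull (\<Union>\<alpha>. sd_basis \<alpha>)" and x: "\<And>i. x i \<ge> 0"
  shows "(\<Sum>i\<in>UNIV. \<Sum>j\<in>UNIV. comparison A i j * x i * x j) \<ge> 0"
proof -
  obtain k c and X :: "nat \<Rightarrow> real^'n::{finite,linorder}^'n::{finite,linorder}" where A: "A = (\<Sum>m<k. c m *\<^sub>R X m)"
    and K: "\<And>m. m < k \<Longrightarrow> X m \<in> (\<Union>\<alpha>. sd_basis \<alpha>)" and c: "\<And>m. m < k \<Longrightarrow> c m \<ge> 0"
    using assms(1) unfolding conical_hull_def by blast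
  have "0 \<le> (\<Sum>m<k. c m * (\<Sum>i\<in>UNIV. \<Sum>j\<in>UNIV. comparison (X m) i j * x i * x j))"
  proof (rule sum_nonneg, rule mult_nonneg_nonneg)
    fix m assume m: "m \<in> {..<k}"
    then show "0 \<le> c m" using c by simp
    obtain \<alpha> i j where "X m = sd_mat \<alpha> i j"
      using K[of m] m by (auto simp: sd_basis_def)
    then show "0 \<le> (\<Sum>i\<in>UNIV. \<Sum>j\<in>UNIV. comparison (X m) i j * x i * x j)"
      by (simp only: comparison_form_sd_mat)
  qed
  also have "\<dots> = (\<Sum>m<k. \<Sum>i\<in>UNIV. \<Sum>j\<in>UNIV. c m * comparison (X m) i j * (x i * x j))"
    by (simp add: sum_distrib_left mult.assoc)
  also have "\<dots> = (\<Sum>i\<in>UNIV. \<Sum>j\<in>UNIV. (\<Sum>m<k. c m * comparison (X m) i j) * (x i * x j))"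
    unfolding sum_distrib_right
    by (subst sum.swap) (intro sum.cong refl sum.swap)
  also have "\<dots> \<le> (\<Sum>i\<in>UNIV. \<Sum>j\<in>UNIV. comparison A i j * (x i * x j))"
    unfolding A using c x by (intro sum_mono mult_right_mono comparison_sum_le) auto
  finally show ?thesis by (simp add: mult.assoc)
qed

lemma conical_hull_sd_basis_symmetric:
  fixes A :: "real^'n::{finite,linorder}^'n::{finite,linorder}"
  assumes "A \<in> conical_hull (\<Union>\<alpha>. sd_basis \<alpha>)"
  shows "A \<in> sym_mats"
proof -
  obtain k c and X :: "nat \<Rightarrow> real^'n::{finite,linorder}^'n::{finite,linorder}" where A: "A = (\<Sum>m<k. c m *\<^sub>R X m)"
    and K: "\<And>m. m < k \<Longrightarrow> X m \<in> (\<Union>\<alpha>. sd_basis \<alpha>)"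
    using assms unfolding conical_hull_def by blast
  have "X m $ i $ j = X m $ j $ i" if "m < k" for m i j
    using K[OF that] by (auto simp: sd_basis_def sd_mat_nth mult.commute)
  then show ?thesis
    by (auto simp: sym_mats_iff A intro!: sum.cong)
qed

theorem corollary3p6:
  shows "conical_hull (\<Union>\<alpha>::real. sd_basis \<alpha>)
    = (SDD :: (real^'n::{finite,linorder}^'n::{finite,linorder}) set)"
proof (intro set_eqI iffI)
  fix A :: "real^'n::{finite,linorder}^'n::{finite,linorder}"
  assume hull: "A \<in> conical_hull (\<Union>\<alpha>. sd_basis \<alpha>)"
  then have A: "A \<in> sym_mats" by (rule conical_hull_sd_basis_symmetric)
  have "\<exists>d. (\<forall>i. d i > 0) \<and> (\<forall>i\<in>UNIV. (\<Sum>j\<in>UNIV. comparison A i j * d j) \<ge> 0)"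
  proof (rule copositive_Z_matrix_dominant)
    show "comparison A i j = comparison A j i" for i j
      using A by (simp add: comparison_def sym_mats_iff)
  qed (use comparison_form_conical_hull[OF hull] in \<open>auto simp: comparison_def\<close>)
  then obtain d where d: "\<And>i. d i > 0" "\<And>i. (\<Sum>j\<in>UNIV. comparison A i j * d j) \<ge> 0"
    by auto
  have "(\<Sum>j\<in>UNIV - {i}. \<bar>A $ i $ j\<bar> * d j) \<le> A $ i $ i * d i" for i
  proof -
    have "(\<Sum>j\<in>UNIV. comparison A i j * d j) =
        comparison A i i * d i + (\<Sum>j\<in>UNIV - {i}. comparison A i j * d j)"
      by (rule sum.remove) auto
    also have "(\<Sum>j\<in>UNIV - {i}. comparison A i j * d j) = (\<Sum>j\<in>UNIV - {i}. - (\<bar>A $ i $ j\<bar> * d j))"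
      by (intro sum.cong) (auto simp: comparison_def)
    finally show ?thesis
      using d(2)[of i] by (simp add: comparison_def sum_negf)
  qed
  with A d(1) show "A \<in> SDD" by (auto simp: SDD_iff)
next
  fix A :: "real^'n::{finite,linorder}^'n::{finite,linorder}"
  assume "A \<in> SDD"
  then show "A \<in> conical_hull (\<Union>\<alpha>. sd_basis \<alpha>)"
    by (auto simp: SDD_iff intro: scaled_dominant_in_conical_hull)
qed

end
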